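(* The smallest order of a ring that is abelian, not semicommutative and not reflexive is $64$, and the ring $$\frac{\mathbb{F}_2\langle u,v\rangle}{\langle u^2,\,v^2,\,uvu-vuv\rangle}$$ is an abelian, nonsemicommutative, nonreflexive ring of order $64$.
   Context: All rings are associative with unity. A ring $R$ is abelian if each idempotent of $R$ is central; semicommutative if for all $a,b\in R$, $ab=0$ implies $aRb=0$; reflexive if for all $a,b\in R$, $aRb=0$ implies $bRa=0$. $\mathbb{F}_2\langle u,v\rangle$ is the free (noncommutative) associative unital $\mathbb{F}_2$-algebra on $u,v$, and $\langle\cdots\rangle$ in the denominator denotes the two-sided ideal generated by the listed elements. *)

theory Defs
  imports "HOL-Algebra.Algebra" "HOL-Algebra.Algebraic_Closure_Type"
    "HOL-Library.Poly_Mapping" "HOL-Library.Z2"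
begin

definition abelian_ring :: "('a, 'm) ring_scheme \<Rightarrow> bool" where
  "abelian_ring R \<longleftrightarrow>
    (\<forall>e\<in>carrier R. e \<otimes>\<^bsub>R\<^esub> e = e \<longrightarrow> (\<forall>x\<in>carrier R. e \<otimes>\<^bsub>R\<^esub> x = x \<otimes>\<^bsub>R\<^esub> e))"

definition semicommutative_ring :: "('a, 'm) ring_scheme \<Rightarrow> bool" where
  "semicommutative_ring R \<longleftrightarrow>
    (\<forall>a\<in>carrier R. \<forall>b\<in>carrier R. a \<otimes>\<^bsub>R\<^esub> b = \<zero>\<^bsub>R\<^esub> \<longrightarrow>
      (\<forall>r\<in>carrier R. a \<otimes>\<^bsub>R\<^esub> r \<otimes>\<^bsub>R\<^esub> b = \<zero>\<^bsub>R\<^esub>))"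

definition reflexive_ring :: "('a, 'm) ring_scheme \<Rightarrow> bool" where
  "reflexive_ring R \<longleftrightarrow>
    (\<forall>a\<in>carrier R. \<forall>b\<in>carrier R. (\<forall>r\<in>carrier R. a \<otimes>\<^bsub>R\<^esub> r \<otimes>\<^bsub>R\<^esub> b = \<zero>\<^bsub>R\<^esub>) \<longrightarrow>
      (\<forall>r\<in>carrier R. b \<otimes>\<^bsub>R\<^esub> r \<otimes>\<^bsub>R\<^esub> a = \<zero>\<^bsub>R\<^esub>))"

text \<open>
  The free monoid is written additively, because the convolution product on
  \<^typ>\<open>'a \<Rightarrow>\<^sub>0 'b\<close> takes its exponents in a \<^class>\<open>monoid_add\<close>.  Addition is
  concatenation of words, hence not commutative.
\<close>

datatype 'a free_monoid = Word (letters: "'a list")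

instantiation free_monoid :: (type) monoid_add
begin

definition zero_free_monoid :: "'a free_monoid" where
  "0 = Word []"

definition plus_free_monoid :: "'a free_monoid \<Rightarrow> 'a free_monoid \<Rightarrow> 'a free_monoid" where
  "x + y = Word (letters x @ letters y)"

instance
  by standard (simp_all add: zero_free_monoid_def plus_free_monoid_def)

end

text \<open>
  The free algebra over \<open>'k\<close> on the set of all elements of \<open>'x\<close> is the monoid algebra
  of the free monoid on \<open>'x\<close>: finitely supported functions from words to \<open>'k\<close> with the
  convolution product.
\<close>

type_synonym ('x, 'k) free_algebra = "'x free_monoid \<Rightarrow>\<^sub>0 'k"

definition generator :: "'x \<Rightarrow> ('x, 'k::ring_1) free_algebra" where
  "generator x = Poly_Mapping.single (Word [x]) 1"

datatype uv = U | V

type_synonym F2_uv = "(uv, bit) free_algebra"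

definition F2_uv_ring :: "F2_uv ring" where
  "F2_uv_ring = ring_of_type_algebra"

definition uv_relators :: "F2_uv set" where
  "uv_relators = (let u = generator U; v = generator V in {u^2, v^2, u * v * u - v * u * v})"

definition uv_quotient :: "F2_uv set ring" where
  "uv_quotient = F2_uv_ring Quot (Idl\<^bsub>F2_uv_ring\<^esub> uv_relators)"

end

(*
A finite abelian ring R with ab = 0 and arb nonzero already has at least 64 elements.  Multiplying by
a central idempotent e with e(arb) nonzero and eR as small as possible, one may assume that 0 and 1
are the only idempotents.  By finiteness every element is then nilpotent or invertible, and the set J
of nilpotents is an ideal with q = |R/J| > 1.  The elements a and b lie in J.  If L < M are left
ideals, then |M| >= q |L|; moreover R(jx) < Rx for j in J and x nonzero.
If r, r - 1 and 1 + r all lie outside J, then q >= 4 and R > R(rb) > R(arb) > 0 gives 4^3.  Otherwise r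
may be taken in J, and R > Rb > R(rb) > R(arb) > 0 gives 81 if q >= 3.  If q = 2, a case distinction
produces a chain of left ideals with six strict inclusions, whence 2^6.

For the example, words are evaluated in the 64-element ring with basis 1, u, v, uv, vu, uvu; the
kernel is the ideal of relators because every element is congruent to its normal form.
*)
theory Submission
  imports Defs
begin

section \<open>Differences and idempotent powers\<close>

lemma (in ring) add_eq_imp_minus_eq:
  assumes "a \<in> carrier R" "b \<in> carrier R" "c \<in> carrier R" "d \<in> carrier R"
    and "a \<oplus> b = c \<oplus> d"
  shows "a \<ominus> c = d \<ominus> b"
proof -
  have "a \<ominus> c = (a \<oplus> b) \<ominus> b \<ominus> c"
    using assms(1-4) by algebra
  also have "\<dots> = d \<ominus> b"
    unfolding assms(5) using assms(1-4) by algebra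
  finally show ?thesis .
qed

lemma (in ring) nat_pow_idempotent:
  assumes "finite (carrier R)" "x \<in> carrier R"
  obtains n :: nat where "n > 0" "x [^] n \<otimes> x [^] n = x [^] n"
proof -
  have "\<not> inj (\<lambda>n::nat. x [^] n)"
    using finite_subset[OF _ assms(1), of "range (\<lambda>n::nat. x [^] n)"] assms(2)
    by (auto dest: finite_imageD)
  then obtain i j :: nat where "i \<noteq> j" "x [^] i = x [^] j"
    by (auto simp: inj_on_def)
  then obtain i p :: nat where p: "p > 0" "x [^] i = x [^] (i + p)"
    by (metis less_imp_add_positive linorder_neqE_nat)
  have shift: "x [^] (i + k) = x [^] (i + k + p * m)" for k m
  proof (induction m)
    case (Suc m)
    have "x [^] (i + k) = x [^] i \<otimes> x [^] (k + p * m)"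
      using Suc assms(2) by (simp add: nat_pow_mult add.assoc)
    also have "\<dots> = x [^] (i + p) \<otimes> x [^] (k + p * m)"
      by (simp only: p(2))
    also have "\<dots> = x [^] (i + k + p * Suc m)"
      using assms(2) by (simp add: nat_pow_mult ac_simps)
    finally show ?case .
  qed simp
  \<comment> \<open>A positive multiple of the period \<open>p\<close> that is at least
    \<open>i\<close>; beyond \<open>i\<close> powers repeat with period \<open>p\<close>, so adding
    \<open>n\<close> to the exponent \<open>n\<close> changes nothing.\<close>
  define n where "n = p * Suc i"
  have "n \<ge> i" "n > 0"
    using p(1) by (cases p; simp add: n_def)+
  have "x [^] n \<otimes> x [^] n = x [^] (n + n)"
    using assms(2) by (rule nat_pow_mult)
  also have "\<dots> = x [^] n"
    using shift[of "n - i" "Suc i"] \<open>n \<ge> i\<close> by (simp add: n_def[symmetric] del: mult_Suc_right)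
  finally have "x [^] n \<otimes> x [^] n = x [^] n" .
  with \<open>n > 0\<close> show ?thesis
    by (rule that)
qed

section \<open>Finite rings without nontrivial idempotents\<close>

locale finite_connected_ring = ring +
  assumes finite_carrier: "finite (carrier R)"
    and one_neq_zero: "\<one> \<noteq> \<zero>"
    and idempotent_cases: "\<lbrakk>e \<in> carrier R; e \<otimes> e = e\<rbrakk> \<Longrightarrow> e = \<zero> \<or> e = \<one>"

section \<open>Nilpotent elements and left ideals\<close>

definition (in ring) nilpotents :: "'a set" where
  "nilpotents = {x \<in> carrier R. \<exists>n::nat. x [^] n = \<zero>}"

definition (in ring) left_ideal :: "'a set \<Rightarrow> bool" where
  "left_ideal M \<longleftrightarrow> M \<subseteq> carrier R \<and> \<zero> \<in> M \<and> (\<forall>x\<in>M. \<forall>y\<in>M. x \<oplus> y \<in> M) \<and>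
    (\<forall>s\<in>carrier R. \<forall>x\<in>M. s \<otimes> x \<in> M)"

definition (in ring) left_span :: "'a \<Rightarrow> 'a set" where
  "left_span x = {s \<otimes> x | s. s \<in> carrier R}"

definition (in ring) left_span2 :: "'a \<Rightarrow> 'a \<Rightarrow> 'a set" where
  "left_span2 x y = {s \<otimes> x \<oplus> t \<otimes> y | s t. s \<in> carrier R \<and> t \<in> carrier R}"

text \<open>Replaces the residue ring R/J in counting: once J is an ideal, \<open>card T\<close>
  bounds |R/J| from below, and no quotient has to be formed.\<close>

definition (in ring) separated :: "'a set \<Rightarrow> bool" where
  "separated T \<longleftrightarrow> T \<subseteq> carrier R \<and> (\<forall>s\<in>T. \<forall>t\<in>T. s \<ominus> t \<in> nilpotents \<longrightarrow> s = t)"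

lemma (in ring) nilpotents_closed: "x \<in> nilpotents \<Longrightarrow> x \<in> carrier R"
  by (simp add: nilpotents_def)

text \<open>A Nakayama argument for one element: iterating the equation lets every power of j fix x,
  including the power that is zero.\<close>

lemma (in ring) nilpotent_fixes_imp_zero:
  assumes "j \<in> nilpotents" "x \<in> carrier R" "j \<otimes> x = x"
  shows "x = \<zero>"
proof -
  obtain n :: nat where n: "j [^] n = \<zero>" and j: "j \<in> carrier R"
    using assms(1) by (auto simp: nilpotents_def)
  have "j [^] k \<otimes> x = x" for k :: nat
    by (induction k) (use assms j in \<open>simp_all add: m_assoc\<close>)
  from this[of n] show ?thesis
    using n assms(2) by simp
qed

lemma (in ring) nilpotent_annihilates:
  assumes "p \<in> nilpotents" "\<one> \<noteq> \<zero>"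
  obtains c where "c \<in> carrier R" "c \<noteq> \<zero>" "p \<otimes> c = \<zero>"
proof -
  obtain n :: nat where n: "p [^] n = \<zero>" and p: "p \<in> carrier R"
    using assms(1) by (auto simp: nilpotents_def)
  \<comment> \<open>The last nonzero power of p is annihilated by p; it exists because the zeroth
    power is nonzero.\<close>
  define m where "m = (LEAST n::nat. p [^] n = \<zero>)"
  have m: "p [^] m = \<zero>"
    unfolding m_def using n by (rule LeastI)
  obtain k where k: "m = Suc k"
    using m assms(2) by (cases m) auto
  have "p [^] k \<noteq> \<zero>"
    using not_less_Least[of k "\<lambda>n. p [^] n = \<zero>"] k by (simp add: m_def)
  moreover have "p \<otimes> p [^] k = \<zero>"
    using m p unfolding k by (simp only: nat_pow_Suc2)
  ultimately show ?thesis
    using p by (intro that[of "p [^] k"]) auto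
qed

lemma (in ring) left_ideal_left_span:
  assumes "x \<in> carrier R"
  shows "left_ideal (left_span x)"
  unfolding left_ideal_def
proof (intro conjI ballI)
  show "left_span x \<subseteq> carrier R"
    using assms by (auto simp: left_span_def)
  show "\<zero> \<in> left_span x"
    using assms by (auto simp: left_span_def intro!: exI[of _ \<zero>])
  fix y assume "y \<in> left_span x"
  then obtain s where s: "s \<in> carrier R" "y = s \<otimes> x"
    by (auto simp: left_span_def)
  show "t \<otimes> y \<in> left_span x" if "t \<in> carrier R" for t
    using that s assms by (auto simp: left_span_def m_assoc intro!: exI[of _ "t \<otimes> s"])
  show "y \<oplus> z \<in> left_span x" if "z \<in> left_span x" for z
  proof -
    obtain t where "t \<in> carrier R" "z = t \<otimes> x"
      using \<open>z \<in> left_span x\<close> unfolding left_span_def by blast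
    then show ?thesis
      using s assms by (auto simp: left_span_def l_distr intro!: exI[of _ "s \<oplus> t"])
  qed
qed

lemma (in ring) left_ideal_left_span2:
  assumes "x \<in> carrier R" "y \<in> carrier R"
  shows "left_ideal (left_span2 x y)"
  unfolding left_ideal_def
proof (intro conjI ballI)
  show "left_span2 x y \<subseteq> carrier R"
    using assms by (auto simp: left_span2_def)
  show "\<zero> \<in> left_span2 x y"
    using assms by (auto simp: left_span2_def intro!: exI[of _ \<zero>])
  fix z assume "z \<in> left_span2 x y"
  then obtain s t where s: "s \<in> carrier R" "t \<in> carrier R" "z = s \<otimes> x \<oplus> t \<otimes> y"
    by (auto simp: left_span2_def)
  show "u \<otimes> z \<in> left_span2 x y" if "u \<in> carrier R" for u
    unfolding left_span2_def mem_Collect_eq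
    by (rule exI[of _ "u \<otimes> s"], rule exI[of _ "u \<otimes> t"])
      (use that s assms in \<open>simp add: m_assoc r_distr\<close>)
  show "z \<oplus> w \<in> left_span2 x y" if "w \<in> left_span2 x y" for w
  proof -
    obtain s' t' where "s' \<in> carrier R" "t' \<in> carrier R" "w = s' \<otimes> x \<oplus> t' \<otimes> y"
      using \<open>w \<in> left_span2 x y\<close> unfolding left_span2_def by blast
    then show ?thesis
      unfolding left_span2_def mem_Collect_eq
      by (intro exI[of _ "s \<oplus> s'"] exI[of _ "t \<oplus> t'"])
        (use s assms in \<open>simp add: l_distr a_ac\<close>)
  qed
qed

lemma (in ring) left_span_subset_left_span2:
  assumes "x \<in> carrier R" "y \<in> carrier R"
  shows "left_span x \<subseteq> left_span2 x y" "left_span y \<subseteq> left_span2 x y"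
proof -
  have "s \<otimes> x = s \<otimes> x \<oplus> \<zero> \<otimes> y" "s \<otimes> y = \<zero> \<otimes> x \<oplus> s \<otimes> y" if "s \<in> carrier R" for s
    using that assms by simp_all
  then show "left_span x \<subseteq> left_span2 x y" "left_span y \<subseteq> left_span2 x y"
    unfolding left_span_def left_span2_def by blast+
qed

lemma (in ring) mem_left_span: "x \<in> carrier R \<Longrightarrow> x \<in> left_span x"
  by (auto simp: left_span_def intro!: exI[of _ \<one>])

lemma (in ring) left_span_subset: "\<lbrakk>left_ideal M; x \<in> M\<rbrakk> \<Longrightarrow> left_span x \<subseteq> M"
  by (auto simp: left_ideal_def left_span_def)

lemma (in ring) left_span2_subset: "\<lbrakk>left_ideal M; x \<in> M; y \<in> M\<rbrakk> \<Longrightarrow> left_span2 x y \<subseteq> M"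
  by (auto simp: left_ideal_def left_span2_def)

lemma (in ring) left_ideal_carrier: "left_ideal (carrier R)"
  by (auto simp: left_ideal_def)

lemma (in ring) left_span_zero: "left_span \<zero> = {\<zero>}"
  by (auto simp: left_span_def intro: exI[of _ \<zero>])

text \<open>If x = s(jx), then the nilpotent sj fixes x and x = 0. Nilpotency of sj enters as a
  hypothesis, since in a general ring a left multiple of a nilpotent need not be nilpotent.\<close>

lemma (in ring) left_span_nilpotent_mult:
  assumes "j \<in> nilpotents" "x \<in> carrier R" "x \<noteq> \<zero>"
    and closed: "\<And>s. s \<in> carrier R \<Longrightarrow> s \<otimes> j \<in> nilpotents"
  shows "left_span (j \<otimes> x) \<subset> left_span x"
proof -
  have j: "j \<in> carrier R"
    using assms(1) by (rule nilpotents_closed)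
  have "x \<notin> left_span (j \<otimes> x)"
    using nilpotent_fixes_imp_zero[OF closed assms(2)] assms(2,3) j
    by (force simp: left_span_def m_assoc)
  moreover have "left_span (j \<otimes> x) \<subseteq> left_span x"
    using left_span_subset[OF left_ideal_left_span] assms(2) j by (auto simp: left_span_def)
  ultimately show ?thesis
    using mem_left_span[OF assms(2)] by blast
qed

section \<open>Units and nilpotents: the ring is local\<close>

context finite_connected_ring
begin

text \<open>Some positive power of x is idempotent, hence 0 or 1, and 0 is excluded. The preceding
  power is then an inverse.\<close>

lemma left_inverse:
  assumes "x \<in> carrier R" "x \<notin> nilpotents"
  obtains y where "y \<in> carrier R" "y \<otimes> x = \<one>"
proof -
  obtain n :: nat where n: "n > 0" "x [^] n \<otimes> x [^] n = x [^] n"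
    using nat_pow_idempotent[OF finite_carrier assms(1)] .
  then have "x [^] n = \<one>"
    using idempotent_cases[of "x [^] n"] assms by (auto simp: nilpotents_def)
  moreover obtain k where "n = Suc k"
    using n(1) gr0_conv_Suc by auto
  ultimately show ?thesis
    using assms(1) by (intro that[of "x [^] k"]) auto
qed

lemma left_invertible_not_nilpotent:
  assumes "x \<in> nilpotents" "y \<in> carrier R"
  shows "y \<otimes> x \<noteq> \<one>"
proof
  assume yx: "y \<otimes> x = \<one>"
  obtain c where c: "c \<in> carrier R" "c \<noteq> \<zero>" "x \<otimes> c = \<zero>"
    using nilpotent_annihilates[OF assms(1) one_neq_zero] .
  have "c = y \<otimes> (x \<otimes> c)"
    using yx c(1) assms by (simp add: m_assoc[symmetric] nilpotents_closed)
  with c assms show False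
    by simp
qed

text \<open>Otherwise y(sx) = 1 for some y, and ys would be a left inverse of the nilpotent
  x.\<close>

lemma nilpotents_mult_left:
  assumes "x \<in> nilpotents" "s \<in> carrier R"
  shows "s \<otimes> x \<in> nilpotents"
proof (rule ccontr)
  assume "s \<otimes> x \<notin> nilpotents"
  then obtain y where "y \<in> carrier R" "y \<otimes> (s \<otimes> x) = \<one>"
    using left_inverse[of "s \<otimes> x"] assms nilpotents_closed by auto
  then show False
    using left_invertible_not_nilpotent[OF assms(1), of "y \<otimes> s"] assms
    by (simp add: m_assoc nilpotents_closed)
qed

lemma nilpotents_mult_right:
  assumes "x \<in> nilpotents" "s \<in> carrier R"
  shows "x \<otimes> s \<in> nilpotents"
proof -
  obtain n :: nat where n: "(s \<otimes> x) [^] n = \<zero>" and x: "x \<in> carrier R"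
    using nilpotents_mult_left[OF assms] assms(1) by (auto simp: nilpotents_def)
  \<comment> \<open>Regrouping the factors passes nilpotency from sx to xs, at the cost of one more
    power.\<close>
  have "(x \<otimes> s) [^] Suc k = x \<otimes> (s \<otimes> x) [^] k \<otimes> s" for k :: nat
  proof (induction k)
    case (Suc k)
    have "(x \<otimes> s) [^] Suc (Suc k) = (x \<otimes> s) [^] Suc k \<otimes> (x \<otimes> s)"
      by (rule nat_pow_Suc)
    then show ?case
      unfolding Suc using x assms(2) by (simp add: m_assoc)
  qed (use x assms(2) in simp)
  from this[of n] show ?thesis
    using n x assms(2) unfolding nilpotents_def
    by (intro CollectI conjI exI[of _ "Suc n"]) (simp_all del: nat_pow_Suc)
qed

lemma one_not_nilpotent: "\<one> \<notin> nilpotents"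
  using left_invertible_not_nilpotent[of \<one> \<one>] by auto

lemma nilpotents_uminus_iff: "x \<in> carrier R \<Longrightarrow> \<ominus> x \<in> nilpotents \<longleftrightarrow> x \<in> nilpotents"
  using nilpotents_mult_left[of x "\<ominus> \<one>"] nilpotents_mult_left[of "\<ominus> x" "\<ominus> \<one>"]
  by (auto simp: l_minus)

text \<open>If z(x + y) = 1 and zx kills a nonzero c, then the nilpotent zy fixes c, which is
  impossible.\<close>

lemma nilpotents_add:
  assumes "x \<in> nilpotents" "y \<in> nilpotents"
  shows "x \<oplus> y \<in> nilpotents"
proof (rule ccontr)
  assume "x \<oplus> y \<notin> nilpotents"
  then obtain z where z: "z \<in> carrier R" "z \<otimes> (x \<oplus> y) = \<one>"
    using left_inverse[of "x \<oplus> y"] assms nilpotents_closed by auto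
  have *: "z \<otimes> x \<in> nilpotents" "z \<otimes> y \<in> nilpotents"
    using nilpotents_mult_left assms z(1) by auto
  obtain c where c: "c \<in> carrier R" "c \<noteq> \<zero>" "z \<otimes> x \<otimes> c = \<zero>"
    using nilpotent_annihilates[OF *(1) one_neq_zero] .
  have "c = z \<otimes> (x \<oplus> y) \<otimes> c"
    using c z by simp
  also have "\<dots> = z \<otimes> y \<otimes> c"
    using c z(1) assms by (simp add: r_distr l_distr nilpotents_closed)
  finally show False
    using nilpotent_fixes_imp_zero[OF *(2) c(1)] c(2) by simp
qed

lemma left_ideal_nilpotents: "left_ideal nilpotents"
  unfolding left_ideal_def
  using nilpotents_add nilpotents_mult_left
  by (auto simp: nilpotents_def intro!: exI[of _ "Suc 0"])

section \<open>Counting along chains of left ideals\<close>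

lemma card_separated_mult_le:
  assumes T: "separated T" and N: "left_ideal N" and M: "left_ideal M" and "N \<subset> M"
  shows "card T * card N \<le> card M"
proof -
  \<comment> \<open>For such an m the cosets tm + N with t in T are pairwise disjoint subsets of M:
    if two of them met, (t - t')m would lie in N, and an invertible t - t' would force m into
    N.\<close>
  obtain m where m: "m \<in> M" "m \<notin> N" "m \<in> carrier R"
    using assms by (auto simp: left_ideal_def)
  have Tc: "T \<subseteq> carrier R" and Nc: "N \<subseteq> carrier R" and Mc: "M \<subseteq> carrier R"
    using assms by (auto simp: left_ideal_def separated_def)
  have N_neg: "\<ominus> n \<in> N" if "n \<in> N" for n
  proof -
    have "(\<ominus> \<one>) \<otimes> n \<in> N"
      using N that by (auto simp: left_ideal_def)
    then show ?thesis
      using that Nc by (auto simp: l_minus)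
  qed
  have *: "t = t' \<and> n = n'"
    if "t \<in> T" "t' \<in> T" "n \<in> N" "n' \<in> N" and eq: "t \<otimes> m \<oplus> n = t' \<otimes> m \<oplus> n'" for t t' n n'
  proof -
    have tc: "t \<in> carrier R" "t' \<in> carrier R" "n \<in> carrier R" "n' \<in> carrier R"
      using that Tc Nc by auto
    have "(t \<ominus> t') \<otimes> m = t \<otimes> m \<ominus> t' \<otimes> m"
      using tc m(3) by (simp add: minus_eq l_distr l_minus)
    also have "\<dots> = n' \<ominus> n"
      using add_eq_imp_minus_eq[OF _ _ _ _ eq] tc m(3) by simp
    also have "\<dots> \<in> N"
      using N N_neg that by (auto simp: minus_eq left_ideal_def)
    finally have d: "(t \<ominus> t') \<otimes> m \<in> N" .
    have "t \<ominus> t' \<in> nilpotents"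
    proof (rule ccontr)
      assume "t \<ominus> t' \<notin> nilpotents"
      then obtain y where "y \<in> carrier R" "y \<otimes> (t \<ominus> t') = \<one>"
        using left_inverse[of "t \<ominus> t'"] tc by auto
      moreover from this have "y \<otimes> ((t \<ominus> t') \<otimes> m) \<in> N"
        using N d by (auto simp: left_ideal_def)
      ultimately have "m \<in> N"
        using tc m(3) by (simp add: m_assoc[symmetric])
      with m(2) show False ..
    qed
    then have "t = t'"
      using T that by (auto simp: separated_def)
    with eq show ?thesis
      using tc m(3) by simp
  qed
  then have "inj_on (\<lambda>(t, n). t \<otimes> m \<oplus> n) (T \<times> N)"
    by (fastforce intro!: inj_onI)
  moreover have "(\<lambda>(t, n). t \<otimes> m \<oplus> n) ` (T \<times> N) \<subseteq> M"
    using M m(1) Tc \<open>N \<subset> M\<close> by (auto simp: left_ideal_def subset_iff)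
  moreover have "finite M"
    using Mc finite_carrier finite_subset by blast
  ultimately have "card (T \<times> N) \<le> card M"
    by (metis card_image card_mono)
  then show ?thesis
    by (simp add: card_cartesian_product)
qed

lemma card_left_span_mult_le:
  assumes "separated T" "j \<in> nilpotents" "x \<in> carrier R" "x \<noteq> \<zero>"
  shows "card T * card (left_span (j \<otimes> x)) \<le> card (left_span x)"
  using assms left_span_nilpotent_mult nilpotents_mult_left
  by (intro card_separated_mult_le left_ideal_left_span) (auto simp: nilpotents_closed)

lemma zero_nilpotent: "\<zero> \<in> nilpotents"
  using left_ideal_nilpotents by (simp add: left_ideal_def)

lemma separated_empty: "separated {}"
  by (simp add: separated_def)

lemma separated_insert:
  assumes T: "separated T" and s: "s \<in> carrier R" and diff: "\<And>t. t \<in> T \<Longrightarrow> t \<ominus> s \<notin> nilpotents"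
  shows "separated (insert s T)"
proof -
  have "s \<ominus> t \<notin> nilpotents" if "t \<in> T" for t
  proof -
    have t: "t \<in> carrier R"
      using T that by (auto simp: separated_def)
    have "s \<ominus> t = \<ominus> (t \<ominus> s)"
      using s t by (simp add: minus_eq minus_add a_comm)
    then show ?thesis
      using diff[OF that] s t nilpotents_uminus_iff[of "t \<ominus> s"] by simp
  qed
  then show ?thesis
    using T s diff by (auto simp: separated_def)
qed

lemma separated_insert_notin:
  assumes "s \<in> carrier R" "\<And>t. t \<in> T \<Longrightarrow> t \<ominus> s \<notin> nilpotents"
  shows "s \<notin> T"
  using assms zero_nilpotent by (metis minus_eq r_neg)

lemma separated_zero_one: "separated {\<zero>, \<one>}"
  using one_not_nilpotent
  by (intro separated_insert separated_empty) (auto simp: minus_eq)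

lemma double_card_le:
  assumes "left_ideal N" "left_ideal M" "N \<subset> M"
  shows "2 * card N \<le> card M"
  using card_separated_mult_le[OF separated_zero_one assms] one_neq_zero by simp

lemma double_card_left_span_le:
  assumes "j \<in> nilpotents" "x \<in> carrier R" "x \<noteq> \<zero>"
  shows "2 * card (left_span (j \<otimes> x)) \<le> card (left_span x)"
  using card_left_span_mult_le[OF separated_zero_one assms] one_neq_zero by simp

lemma card_left_span_ge:
  assumes "separated T" "x \<in> carrier R" "x \<noteq> \<zero>"
  shows "card T \<le> card (left_span x)"
  \<comment> \<open>With the nilpotent 0 the smaller span is {0}, which has one element.\<close>
  using card_left_span_mult_le[OF assms(1) zero_nilpotent assms(2,3)] assms(2)
  by (simp add: left_span_zero)

section \<open>The bound 64 for rings without nontrivial idempotents\<close>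

lemma left_span_one: "left_span \<one> = carrier R"
proof -
  have "x \<in> left_span \<one>" if "x \<in> carrier R" for x
    using that unfolding left_span_def mem_Collect_eq by (intro exI[of _ x]) simp
  then show ?thesis
    using left_ideal_left_span[of \<one>] by (auto simp: left_ideal_def)
qed

lemma double_card_nilpotents_le: "2 * card nilpotents \<le> card (carrier R)"
  using one_not_nilpotent nilpotents_closed
  by (intro double_card_le left_ideal_nilpotents left_ideal_carrier) auto

text \<open>With two residue classes each strict inclusion only doubles. Rb > R(rb) > R(arb) > 0
  gives |Rb| \<ge> 8, so three more doublings are needed. Where they come from depends on whether a
  lies in Rb, and then on whether s in a = sb is invertible.\<close>

lemma card_ge_64_residue_field_two:
  assumes a: "a \<in> nilpotents" and r: "r \<in> nilpotents" and b: "b \<in> nilpotents"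
    and ab: "a \<otimes> b = \<zero>" and arb: "a \<otimes> (r \<otimes> b) \<noteq> \<zero>"
    and residue: "\<And>t. t \<in> carrier R \<Longrightarrow> t \<in> nilpotents \<or> t \<ominus> \<one> \<in> nilpotents"
  shows "64 \<le> card (carrier R)"
proof -
  note cl [simp] = nilpotents_closed[OF a] nilpotents_closed[OF r] nilpotents_closed[OF b]
  let ?c = "\<lambda>x. card (left_span x)"
  have ge2: "2 \<le> ?c x" if "x \<in> carrier R" "x \<noteq> \<zero>" for x
    using card_left_span_ge[OF separated_zero_one that] one_neq_zero by simp
  have rb: "r \<otimes> b \<noteq> \<zero>" and b0: "b \<noteq> \<zero>"
    using arb by auto
  \<comment> \<open>Since ab = 0, replacing t by t - 1 does not change atb, and one of the two is
    nilpotent.\<close>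
  have nilpotent_coeff: "\<exists>j\<in>nilpotents. a \<otimes> (t \<otimes> b) = a \<otimes> (j \<otimes> b)" if "t \<in> carrier R" for t
  proof (cases "t \<in> nilpotents")
    case False
    have "a \<otimes> ((t \<ominus> \<one>) \<otimes> b) = a \<otimes> (t \<otimes> b)"
      using that ab by (simp add: minus_eq l_distr r_distr l_minus r_minus)
    with False residue[OF that] show ?thesis
      by metis
  qed auto
  have span_b: "left_span b \<subseteq> nilpotents"
    using b nilpotents_mult_left by (auto simp: left_span_def)
  have c_arb: "8 \<le> ?c b"
    using ge2[OF _ arb] double_card_left_span_le[OF a _ rb] double_card_left_span_le[OF r _ b0]
    by simp
  \<comment> \<open>Rb < Rb + Rx \<subseteq> J < R gives two doublings. The third comes either from
    a larger Rb or from r, a nilpotent outside Rb + Rx.\<close>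
  have via_span2: ?thesis if x: "x \<in> nilpotents" "x \<notin> left_span b"
      and ge: "16 \<le> ?c b \<or> r \<notin> left_span2 b x" for x
  proof -
    note xc [simp] = nilpotents_closed[OF x(1)]
    have sub: "left_span2 b x \<subseteq> nilpotents"
      using left_span2_subset[OF left_ideal_nilpotents b x(1)] .
    have "left_span b \<subset> left_span2 b x"
      using left_span_subset_left_span2[of b x] mem_left_span[of x] x(2) by auto
    then have X: "2 * ?c b \<le> card (left_span2 b x)"
      by (intro double_card_le left_ideal_left_span left_ideal_left_span2) simp_all
    have "card (left_span2 b x) \<le> card nilpotents"
      using sub finite_carrier by (intro card_mono) (auto simp: nilpotents_def)
    moreover have "2 * card (left_span2 b x) \<le> card nilpotents" if "r \<notin> left_span2 b x"
      using that sub r by (intro double_card_le left_ideal_nilpotents left_ideal_left_span2) auto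
    ultimately show ?thesis
      using X ge c_arb double_card_nilpotents_le by linarith
  qed
  show ?thesis
  proof (cases "a \<in> left_span b")
    case False
    show ?thesis
    proof (cases "r \<in> left_span2 b a")
      case False
      with via_span2[OF a \<open>a \<notin> left_span b\<close>] show ?thesis by blast
    next
      case True
      then obtain s t where st: "s \<in> carrier R" "t \<in> carrier R" "r = s \<otimes> b \<oplus> t \<otimes> a"
        by (auto simp: left_span2_def)
      obtain j where j: "j \<in> nilpotents" "a \<otimes> (s \<otimes> b) = a \<otimes> (j \<otimes> b)"
        using nilpotent_coeff st(1) by blast
      note jc [simp] = nilpotents_closed[OF j(1)]
      \<comment> \<open>The summand ta of r contributes at(ab) = 0. With s replaced by j, the chain
        Rb > R(bb) > R(jbb) > R(ajbb) > 0 gives |Rb| \<ge> 16.\<close>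
      have "a \<otimes> (r \<otimes> b) = a \<otimes> (s \<otimes> b) \<otimes> b"
        unfolding st(3) using st(1,2) ab by (simp add: l_distr r_distr m_assoc)
      also have "\<dots> = a \<otimes> (j \<otimes> (b \<otimes> b))"
        unfolding j(2) by (simp add: m_assoc)
      finally have nz: "a \<otimes> (j \<otimes> (b \<otimes> b)) \<noteq> \<zero>"
        using arb by simp
      then have nz2: "j \<otimes> (b \<otimes> b) \<noteq> \<zero>" and nz3: "b \<otimes> b \<noteq> \<zero>"
        by auto
      have "16 \<le> ?c b"
        using ge2[OF _ nz] double_card_left_span_le[OF a _ nz2]
          double_card_left_span_le[OF j(1) _ nz3] double_card_left_span_le[OF b _ b0] by simp
      with via_span2[OF a False] show ?thesis by blast
    qed
  next
    case True
    then obtain s where s: "s \<in> carrier R" "a = s \<otimes> b"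
      by (auto simp: left_span_def)
    note [simp] = s(1)
    have sbrb: "s \<otimes> (b \<otimes> (r \<otimes> b)) \<noteq> \<zero>"
      using arb unfolding s(2) by (simp add: m_assoc)
    then have brb: "b \<otimes> (r \<otimes> b) \<noteq> \<zero>"
      by auto
    show ?thesis
    proof (cases "s \<in> nilpotents")
      case False
      then obtain y where y: "y \<in> carrier R" "y \<otimes> s = \<one>"
        using left_inverse[OF s(1)] by blast
      \<comment> \<open>An invertible s cancels from s(bb) = ab = 0, so bb = 0 and every element of
        Rb annihilates b from the left.\<close>
      have "b \<otimes> b = y \<otimes> s \<otimes> (b \<otimes> b)"
        using y by simp
      also have "\<dots> = y \<otimes> (a \<otimes> b)"
        unfolding s(2) using y(1) by (simp add: m_assoc)
      finally have bb: "b \<otimes> b = \<zero>"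
        using ab y(1) by simp
      have kill: "x \<otimes> b = \<zero>" if "x \<in> left_span b" for x
        using that bb by (auto simp: left_span_def m_assoc)
      have r_nin: "r \<notin> left_span b"
        using kill rb by blast
      have br_nin: "b \<otimes> r \<notin> left_span b"
        using kill[of "b \<otimes> r"] brb by (auto simp: m_assoc)
      \<comment> \<open>If r = pb + t(br), then (1 - tb)r = pb with 1 - tb invertible, so r would
        lie in Rb.\<close>
      have "r \<notin> left_span2 b (b \<otimes> r)"
      proof
        assume "r \<in> left_span2 b (b \<otimes> r)"
        then obtain p t where pt: "p \<in> carrier R" "t \<in> carrier R"
            and eq: "r = p \<otimes> b \<oplus> t \<otimes> (b \<otimes> r)"
          by (auto simp: left_span2_def)
        have tb: "t \<otimes> b \<in> nilpotents"
          using nilpotents_mult_left[OF b pt(2)] .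
        have "\<one> = (\<one> \<ominus> t \<otimes> b) \<oplus> t \<otimes> b"
          using pt by (simp add: minus_eq a_assoc l_neg)
        then have "\<one> \<ominus> t \<otimes> b \<notin> nilpotents"
          using nilpotents_add[OF _ tb] one_not_nilpotent by metis
        then obtain y where y: "y \<in> carrier R" "y \<otimes> (\<one> \<ominus> t \<otimes> b) = \<one>"
          using left_inverse[of "\<one> \<ominus> t \<otimes> b"] pt by auto
        have "(\<one> \<ominus> t \<otimes> b) \<otimes> r = r \<ominus> t \<otimes> (b \<otimes> r)"
          using pt by (simp add: minus_eq l_distr l_minus m_assoc)
        also have "\<dots> = p \<otimes> b"
          using add_eq_imp_minus_eq[of r \<zero> "t \<otimes> (b \<otimes> r)" "p \<otimes> b"] eq pt
          by (simp add: a_comm minus_eq)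
        finally have "y \<otimes> (p \<otimes> b) = r"
          using y pt by (metis cl m_assoc minus_closed one_closed m_closed l_one)
        then have "r \<in> left_span b"
          using y pt unfolding left_span_def by (metis (mono_tags, lifting) cl(3) m_assoc m_closed mem_Collect_eq)
        with r_nin show False ..
      qed
      then show ?thesis
        using via_span2[OF nilpotents_mult_right[OF b] br_nin] by simp
    next
      case True
      \<comment> \<open>The chain is Rb > R(rb) > R(brb) > R(sbrb) > 0, where sbrb = arb.\<close>
      have c_b: "16 \<le> ?c b"
        using ge2[OF _ sbrb] double_card_left_span_le[OF True _ brb]
          double_card_left_span_le[OF b _ rb] double_card_left_span_le[OF r _ b0] by simp
      show ?thesis
      proof (cases "r \<in> left_span b")
        case False
        then show ?thesis
          using via_span2[OF r False] c_b by blast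
      next
        case True
        then obtain t where t: "t \<in> carrier R" "r = t \<otimes> b"
          by (auto simp: left_span_def)
        obtain j where j: "j \<in> nilpotents" "a \<otimes> (t \<otimes> b) = a \<otimes> (j \<otimes> b)"
          using nilpotent_coeff t(1) by blast
        note jc [simp] = nilpotents_closed[OF j(1)]
        \<comment> \<open>The result arb = sbjbb lengthens the chain: Rb > R(bb) > R(jbb) > R(bjbb)
          > R(sbjbb) > 0 has five strict inclusions, and R > Rb is the sixth.\<close>
        have "a \<otimes> (r \<otimes> b) = a \<otimes> (t \<otimes> b) \<otimes> b"
          unfolding t(2) using t(1) by (simp add: m_assoc)
        also have "\<dots> = a \<otimes> (j \<otimes> b) \<otimes> b"
          by (simp only: j(2))
        also have "\<dots> = s \<otimes> (b \<otimes> (j \<otimes> (b \<otimes> b)))"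
          unfolding s(2) by (simp add: m_assoc)
        finally have nz: "s \<otimes> (b \<otimes> (j \<otimes> (b \<otimes> b))) \<noteq> \<zero>"
          using arb by simp
        then have nz2: "b \<otimes> (j \<otimes> (b \<otimes> b)) \<noteq> \<zero>" and nz3: "j \<otimes> (b \<otimes> b) \<noteq> \<zero>"
            and nz4: "b \<otimes> b \<noteq> \<zero>"
          by auto
        have "32 \<le> ?c b"
          using ge2[OF _ nz] double_card_left_span_le[OF \<open>s \<in> nilpotents\<close> _ nz2]
            double_card_left_span_le[OF b _ nz3] double_card_left_span_le[OF j(1) _ nz4]
            double_card_left_span_le[OF b _ b0] by simp
        then show ?thesis
          using double_card_left_span_le[OF b one_closed one_neq_zero]
          by (simp add: left_span_one)
      qed
    qed
  qed
qed

lemma card_ge_64: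
  assumes a: "a \<in> carrier R" and r: "r \<in> carrier R" and b: "b \<in> carrier R"
    and ab: "a \<otimes> b = \<zero>" and arb: "a \<otimes> (r \<otimes> b) \<noteq> \<zero>"
  shows "64 \<le> card (carrier R)"
proof -
  note [simp] = a r b
  let ?c = "\<lambda>x. card (left_span x)"
  have b0: "b \<noteq> \<zero>"
    using arb by auto
  have a_nil: "a \<in> nilpotents"
  proof (rule ccontr)
    assume "a \<notin> nilpotents"
    then obtain y where y: "y \<in> carrier R" "y \<otimes> a = \<one>"
      using left_inverse[OF a] by blast
    then have "b = y \<otimes> (a \<otimes> b)"
      by (simp add: m_assoc[symmetric])
    with ab y b0 show False by simp
  qed
  have b_nil: "b \<in> nilpotents"
  proof (rule ccontr)
    assume nb: "b \<notin> nilpotents"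
    then obtain y where y: "y \<in> carrier R" "y \<otimes> b = \<one>"
      using left_inverse[OF b] by blast
    then have "y \<notin> nilpotents"
      using nilpotents_mult_right one_not_nilpotent b by metis
    then obtain z where z: "z \<in> carrier R" "z \<otimes> y = \<one>"
      using left_inverse y(1) by blast
    \<comment> \<open>The left inverse of b is two-sided: z = zyb = b, hence by = 1, and a = aby = 0
      is a contradiction.\<close>
    have "z \<otimes> (y \<otimes> b) = (z \<otimes> y) \<otimes> b"
      using y(1) z(1) by (simp add: m_assoc)
    then have "z = b"
      unfolding y(2) z(2) using z(1) by simp
    then have "a = a \<otimes> b \<otimes> y"
      using y z by (simp add: m_assoc)
    with ab y arb show False by simp
  qed
  show ?thesis
  proof (cases "\<exists>r'\<in>nilpotents. a \<otimes> (r' \<otimes> b) \<noteq> \<zero>")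
    case False
    \<comment> \<open>Between a and b, the elements r - 1 and 1 + r give the same nonzero value as
      r. So none of the three is nilpotent, and 0, 1, r, 1 + r lie in four residue classes.\<close>
    have shifts: "a \<otimes> ((r \<ominus> \<one>) \<otimes> b) \<noteq> \<zero>" "a \<otimes> ((\<one> \<oplus> r) \<otimes> b) \<noteq> \<zero>"
      using ab arb by (simp_all add: minus_eq l_distr r_distr l_minus r_minus)
    have nn: "r \<notin> nilpotents" "r \<ominus> \<one> \<notin> nilpotents" "\<one> \<oplus> r \<notin> nilpotents"
      using False arb shifts by blast+
    have diff: "\<one> \<ominus> \<zero> = \<one>" "r \<ominus> \<zero> = r" "(\<one> \<oplus> r) \<ominus> \<zero> = \<one> \<oplus> r"
      "(\<one> \<oplus> r) \<ominus> \<one> = r" "(\<one> \<oplus> r) \<ominus> r = \<one>"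
      using r by (simp_all add: minus_eq a_assoc r_neg a_comm[of \<one> "r \<oplus> \<ominus> \<one>"] l_neg)
    define T where "T = {\<zero>, \<one>, r, \<one> \<oplus> r}"
    have T: "separated T"
      unfolding T_def using nn one_not_nilpotent
      by (intro separated_insert separated_empty) (auto simp: diff)
    have "\<zero> \<notin> {\<one>, r, \<one> \<oplus> r}" "\<one> \<notin> {r, \<one> \<oplus> r}" "r \<notin> {\<one> \<oplus> r}"
      by (rule separated_insert_notin; use nn one_not_nilpotent in \<open>auto simp: diff\<close>)+
    then have "card T = 4"
      unfolding T_def by simp
    have rb: "r \<otimes> b \<in> nilpotents" "r \<otimes> b \<noteq> \<zero>"
      using arb nilpotents_mult_left[OF b_nil r] by auto
    have "4 \<le> ?c (a \<otimes> (r \<otimes> b))" "4 * ?c (a \<otimes> (r \<otimes> b)) \<le> ?c (r \<otimes> b)"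
      "4 * ?c (r \<otimes> b) \<le> card (carrier R)"
      using card_left_span_ge[OF T _ arb] card_left_span_mult_le[OF T a_nil _ rb(2)]
        card_left_span_mult_le[OF T rb(1) one_closed one_neq_zero] \<open>card T = 4\<close>
      by (simp_all add: left_span_one)
    then show ?thesis by linarith
  next
    case True
    then obtain r' where r': "r' \<in> nilpotents" and ar'b: "a \<otimes> (r' \<otimes> b) \<noteq> \<zero>"
      by blast
    note [simp] = nilpotents_closed[OF r']
    have r'b: "r' \<otimes> b \<noteq> \<zero>"
      using ar'b by auto
    show ?thesis
    proof (cases "\<forall>t\<in>carrier R. t \<in> nilpotents \<or> t \<ominus> \<one> \<in> nilpotents")
      case True
      then show ?thesis
        using card_ge_64_residue_field_two[OF a_nil r' b_nil ab ar'b] by blast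
    next
      case False
      \<comment> \<open>t represents a third residue class, so the four strict inclusions R > Rb >
        R(r'b) > R(ar'b) > 0 give 81.\<close>
      then obtain t where t: "t \<in> carrier R" "t \<notin> nilpotents" "t \<ominus> \<one> \<notin> nilpotents"
        by blast
      note [simp] = t(1)
      have diff: "\<one> \<ominus> \<zero> = \<one>" "t \<ominus> \<zero> = t"
        by (simp_all add: minus_eq)
      define T where "T = {\<zero>, \<one>, t}"
      have T: "separated T"
        unfolding T_def using t one_not_nilpotent
        by (intro separated_insert separated_empty) (auto simp: diff)
      have "\<zero> \<notin> {\<one>, t}" "\<one> \<notin> {t}"
        by (rule separated_insert_notin; use t one_not_nilpotent in \<open>auto simp: diff\<close>)+
      then have "card T = 3"
        unfolding T_def by simp
      have "3 \<le> ?c (a \<otimes> (r' \<otimes> b))" "3 * ?c (a \<otimes> (r' \<otimes> b)) \<le> ?c (r' \<otimes> b)"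
        "3 * ?c (r' \<otimes> b) \<le> ?c b" "3 * ?c b \<le> card (carrier R)"
        using card_left_span_ge[OF T _ ar'b] card_left_span_mult_le[OF T a_nil _ r'b]
          card_left_span_mult_le[OF T r' b b0]
          card_left_span_mult_le[OF T b_nil one_closed one_neq_zero] \<open>card T = 3\<close>
        by (simp_all add: left_span_one)
      then show ?thesis by linarith
    qed
  qed
qed

end

section \<open>Reduction to a minimal corner\<close>

text \<open>Centrality gives (ex)(ey) = e(xy), so the operations of R restrict to eR and e acts
  there as the identity.\<close>

lemma (in ring) ring_corner:
  assumes e: "e \<in> carrier R" "e \<otimes> e = e" and central: "\<And>x. x \<in> carrier R \<Longrightarrow> e \<otimes> x = x \<otimes> e"
  shows "ring (R\<lparr>carrier := (\<otimes>) e ` carrier R, one := e\<rparr>)"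
proof -
  have mult: "(e \<otimes> x) \<otimes> (e \<otimes> y) = e \<otimes> (x \<otimes> y)" if "x \<in> carrier R" "y \<in> carrier R" for x y
  proof -
    have "(e \<otimes> x) \<otimes> (e \<otimes> y) = (x \<otimes> e) \<otimes> (e \<otimes> y)"
      by (simp only: central[OF that(1)])
    also have "\<dots> = (x \<otimes> (e \<otimes> e)) \<otimes> y"
      using that e(1) by (simp only: m_assoc m_closed)
    also have "\<dots> = (e \<otimes> x) \<otimes> y"
      by (simp only: e(2) central[OF that(1)])
    also have "\<dots> = e \<otimes> (x \<otimes> y)"
      using that e(1) by (simp only: m_assoc)
    finally show ?thesis .
  qed
  have absorb: "e \<otimes> (e \<otimes> x) = e \<otimes> x" if "x \<in> carrier R" for x
    using that e by (simp flip: m_assoc)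
  define C where "C = (\<otimes>) e ` carrier R"
  have sub: "x \<in> carrier R" if "x \<in> C" for x
    using that e(1) by (auto simp: C_def)
  have unit: "e \<otimes> x = x" "x \<otimes> e = x" if "x \<in> C" for x
  proof -
    show "e \<otimes> x = x"
      using that absorb by (auto simp: C_def)
    then show "x \<otimes> e = x"
      using central[OF sub[OF that]] by simp
  qed
  have add: "x \<oplus> y \<in> C" if "x \<in> C" "y \<in> C" for x y
  proof -
    from that obtain x' y' where "x' \<in> carrier R" "x = e \<otimes> x'" "y' \<in> carrier R" "y = e \<otimes> y'"
      by (auto simp: C_def)
    then show ?thesis
      using e(1) unfolding C_def by (intro image_eqI[of _ _ "x' \<oplus> y'"]) (simp_all add: r_distr)
  qed
  have times: "x \<otimes> y \<in> C" if "x \<in> C" "y \<in> C" for x y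
  proof -
    from that obtain x' y' where "x' \<in> carrier R" "x = e \<otimes> x'" "y' \<in> carrier R" "y = e \<otimes> y'"
      by (auto simp: C_def)
    then show ?thesis
      using e(1) mult unfolding C_def by (intro image_eqI[of _ _ "x' \<otimes> y'"]) simp_all
  qed
  have zero: "\<zero> \<in> C"
    using e(1) unfolding C_def by (intro image_eqI[of _ _ \<zero>]) auto
  have one: "e \<in> C"
    using e unfolding C_def by (intro image_eqI[of _ _ e]) auto
  have neg: "\<exists>y\<in>C. y \<oplus> x = \<zero>" if "x \<in> C" for x
  proof -
    from that obtain y where y: "y \<in> carrier R" "x = e \<otimes> y"
      by (auto simp: C_def)
    then have "e \<otimes> (\<ominus> y) \<oplus> x = \<zero>"
      using e(1) by (simp add: r_minus l_neg)
    moreover have "e \<otimes> (\<ominus> y) \<in> C"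
      using y(1) by (simp add: C_def)
    ultimately show ?thesis ..
  qed
  have "ring (R\<lparr>carrier := C, one := e\<rparr>)"
  proof (rule ringI)
    show "abelian_group (R\<lparr>carrier := C, one := e\<rparr>)"
      by (rule abelian_groupI) (use add zero neg in \<open>simp_all add: sub a_ac\<close>)
    show "monoid (R\<lparr>carrier := C, one := e\<rparr>)"
      by (rule monoidI) (use times one unit in \<open>simp_all add: sub m_assoc\<close>)
  qed (simp_all add: sub l_distr r_distr)
  then show ?thesis
    by (simp only: C_def)
qed

lemma card_ge_64_if_not_semicommutative:
  fixes R :: "('a, 'm) ring_scheme"
  assumes "ring R" and fin: "finite (carrier R)" and "abelian_ring R" "\<not> semicommutative_ring R"
  shows "64 \<le> card (carrier R)"
proof -
  interpret ring R by fact
  have central: "e \<otimes>\<^bsub>R\<^esub> x = x \<otimes>\<^bsub>R\<^esub> e"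
    if "e \<in> carrier R" "e \<otimes>\<^bsub>R\<^esub> e = e" "x \<in> carrier R" for e x
    using assms(3) that by (auto simp: abelian_ring_def)
  obtain a b r where cl [simp]: "a \<in> carrier R" "b \<in> carrier R" "r \<in> carrier R"
    and ab: "a \<otimes>\<^bsub>R\<^esub> b = \<zero>\<^bsub>R\<^esub>" and arb: "a \<otimes>\<^bsub>R\<^esub> (r \<otimes>\<^bsub>R\<^esub> b) \<noteq> \<zero>\<^bsub>R\<^esub>"
    using assms(4) by (auto simp: semicommutative_ring_def m_assoc)
  let ?w = "a \<otimes>\<^bsub>R\<^esub> (r \<otimes>\<^bsub>R\<^esub> b)"
  define E where "E = {e \<in> carrier R. e \<otimes>\<^bsub>R\<^esub> e = e \<and> e \<otimes>\<^bsub>R\<^esub> ?w \<noteq> \<zero>\<^bsub>R\<^esub>}"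
  define C where "C = (\<lambda>e. (\<lambda>x. e \<otimes>\<^bsub>R\<^esub> x) ` carrier R)"
  have "\<one>\<^bsub>R\<^esub> \<in> E"
    using arb by (simp add: E_def)
  then obtain e where e: "e \<in> E" and min: "\<And>f. f \<in> E \<Longrightarrow> card (C e) \<le> card (C f)"
    using arg_min_nat_lemma[of "\<lambda>e. e \<in> E" _ "\<lambda>e. card (C e)"] by metis
  have ec [simp]: "e \<in> carrier R" and ee: "e \<otimes>\<^bsub>R\<^esub> e = e" and ew: "e \<otimes>\<^bsub>R\<^esub> ?w \<noteq> \<zero>\<^bsub>R\<^esub>"
    using e by (auto simp: E_def)
  have eec: "e \<otimes>\<^bsub>R\<^esub> (e \<otimes>\<^bsub>R\<^esub> x) = e \<otimes>\<^bsub>R\<^esub> x" if "x \<in> carrier R" for x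
    using that ee by (simp flip: m_assoc)
  \<comment> \<open>Minimality forces fR = eR, so e = fy for some y and fe = e; centrality gives fe
    = ef = f.\<close>
  have full: "f = e" if f: "f \<in> E" "e \<otimes>\<^bsub>R\<^esub> f = f" for f
  proof -
    have fc: "f \<in> carrier R" "f \<otimes>\<^bsub>R\<^esub> f = f"
      using f by (auto simp: E_def)
    have "C f \<subseteq> C e"
    proof
      fix x assume "x \<in> C f"
      then obtain y where y: "y \<in> carrier R" "x = f \<otimes>\<^bsub>R\<^esub> y"
        by (auto simp: C_def)
      then have "x = e \<otimes>\<^bsub>R\<^esub> (f \<otimes>\<^bsub>R\<^esub> y)"
        using f(2) fc by (simp flip: m_assoc)
      then show "x \<in> C e"
        using y fc by (auto simp: C_def)
    qed
    then have "C f = C e"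
      using min[OF f(1)] fin by (intro card_seteq) (auto simp: C_def)
    moreover have "e \<in> C e"
      using ee unfolding C_def by (metis ec image_eqI)
    ultimately obtain y where y: "y \<in> carrier R" "e = f \<otimes>\<^bsub>R\<^esub> y"
      by (auto simp: C_def)
    have "f \<otimes>\<^bsub>R\<^esub> (f \<otimes>\<^bsub>R\<^esub> y) = f \<otimes>\<^bsub>R\<^esub> y"
      using y(1) fc by (simp flip: m_assoc)
    then have "f \<otimes>\<^bsub>R\<^esub> e = e"
      by (simp only: y(2))
    moreover have "f \<otimes>\<^bsub>R\<^esub> e = f"
      using central[OF ec ee fc(1)] f(2) by (simp only:)
    ultimately show ?thesis by (simp only:)
  qed
  let ?S = "R\<lparr>carrier := C e, one := e\<rparr>"
  have "ring ?S"
    unfolding C_def by (rule ring_corner[OF ec ee central[OF ec ee]])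
  then interpret S: finite_connected_ring ?S
  proof (rule finite_connected_ring.intro, unfold_locales)
    show "finite (carrier ?S)"
      using fin by (simp add: C_def)
    show "\<one>\<^bsub>?S\<^esub> \<noteq> \<zero>\<^bsub>?S\<^esub>"
      using ew by auto
    fix f assume f: "f \<in> carrier ?S" "f \<otimes>\<^bsub>?S\<^esub> f = f"
    then have fc [simp]: "f \<in> carrier R" and ff: "f \<otimes>\<^bsub>R\<^esub> f = f" and ef: "e \<otimes>\<^bsub>R\<^esub> f = f"
      using eec by (auto simp: C_def)
    have fe: "f \<otimes>\<^bsub>R\<^esub> e = f"
      using central[OF ec ee fc] ef by (simp only:)
    show "f = \<zero>\<^bsub>?S\<^esub> \<or> f = \<one>\<^bsub>?S\<^esub>"
    proof (cases "f \<otimes>\<^bsub>R\<^esub> ?w = \<zero>\<^bsub>R\<^esub>")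
      case False
      then show ?thesis
        using full[of f] ff ef by (auto simp: E_def)
    next
      case True
      \<comment> \<open>When f kills w = arb, the complementary idempotent e - f acts on w as e
        does; minimality then gives e - f = e.\<close>
      let ?g = "e \<ominus>\<^bsub>R\<^esub> f"
      have "?g \<otimes>\<^bsub>R\<^esub> ?g = ?g" "e \<otimes>\<^bsub>R\<^esub> ?g = ?g" "?g \<otimes>\<^bsub>R\<^esub> ?w = e \<otimes>\<^bsub>R\<^esub> ?w"
        using ff ef fe ee True
        by (simp_all add: minus_eq l_distr r_distr l_minus r_minus r_neg)
      then have "e \<ominus>\<^bsub>R\<^esub> f = e"
        using ew by (intro full) (auto simp: E_def)
      moreover have "f = e \<ominus>\<^bsub>R\<^esub> (e \<ominus>\<^bsub>R\<^esub> f)"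
        using ec fc by algebra
      ultimately have "f = e \<ominus>\<^bsub>R\<^esub> e"
        by simp
      then have "f = \<zero>\<^bsub>R\<^esub>"
        by (simp add: minus_eq r_neg)
      then show ?thesis by simp
    qed
  qed
  have mult: "(e \<otimes>\<^bsub>R\<^esub> x) \<otimes>\<^bsub>R\<^esub> (e \<otimes>\<^bsub>R\<^esub> y) = e \<otimes>\<^bsub>R\<^esub> (x \<otimes>\<^bsub>R\<^esub> y)"
    if "x \<in> carrier R" "y \<in> carrier R" for x y
  proof -
    have "(e \<otimes>\<^bsub>R\<^esub> x) \<otimes>\<^bsub>R\<^esub> (e \<otimes>\<^bsub>R\<^esub> y) = (x \<otimes>\<^bsub>R\<^esub> e) \<otimes>\<^bsub>R\<^esub> (e \<otimes>\<^bsub>R\<^esub> y)"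
      by (simp only: central[OF ec ee that(1)])
    also have "\<dots> = (x \<otimes>\<^bsub>R\<^esub> e) \<otimes>\<^bsub>R\<^esub> y"
      using that eec by (simp add: m_assoc)
    also have "\<dots> = e \<otimes>\<^bsub>R\<^esub> (x \<otimes>\<^bsub>R\<^esub> y)"
      using that by (simp add: central[OF ec ee that(1), symmetric] m_assoc)
    finally show ?thesis .
  qed
  \<comment> \<open>The witnesses ea, er, eb have the products e(ab) = 0 and e(arb), which is
    nonzero by the choice of e.\<close>
  have "64 \<le> card (carrier ?S)"
    using ab ew mult
    by (intro S.card_ge_64[of "e \<otimes>\<^bsub>R\<^esub> a" "e \<otimes>\<^bsub>R\<^esub> r" "e \<otimes>\<^bsub>R\<^esub> b"]) (auto simp: C_def)
  also have "\<dots> \<le> card (carrier R)"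
    using fin by (auto simp: C_def intro: card_image_le)
  finally show ?thesis .
qed

section \<open>Transfer along ring isomorphisms\<close>

lemma ring_of_type_algebra_simps [simp]:
  "carrier ring_of_type_algebra = UNIV"
  "x \<otimes>\<^bsub>ring_of_type_algebra\<^esub> y = x * y"
  "\<one>\<^bsub>ring_of_type_algebra\<^esub> = 1"
  "\<zero>\<^bsub>ring_of_type_algebra\<^esub> = 0"
  "x \<oplus>\<^bsub>ring_of_type_algebra\<^esub> y = x + y"
  by (simp_all add: ring_of_type_algebra_def)

lemma ring_ring_of_type_algebra: "ring (ring_of_type_algebra :: 'a::ring_1 ring)"
proof (intro ringI abelian_groupI monoidI; simp add: algebra_simps)
  show "\<exists>y. x + y = 0" for x :: 'a
    by (rule exI[of _ "- x"]) simp
qed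

lemma abelian_ring_iso:
  assumes "ring R" "ring S" "h \<in> ring_iso R S" "abelian_ring S"
  shows "abelian_ring R"
  unfolding abelian_ring_def
proof (intro ballI impI)
  interpret R: ring R by fact
  fix e x assume ex: "e \<in> carrier R" "e \<otimes>\<^bsub>R\<^esub> e = e" "x \<in> carrier R"
  note h = ring_iso_memE[OF assms(3)]
  have "h e \<otimes>\<^bsub>S\<^esub> h e = h e"
    using ex h(2)[of e e] by simp
  then have "h e \<otimes>\<^bsub>S\<^esub> h x = h x \<otimes>\<^bsub>S\<^esub> h e"
    using assms(4) ex h(1) unfolding abelian_ring_def by blast
  then have "h (e \<otimes>\<^bsub>R\<^esub> x) = h (x \<otimes>\<^bsub>R\<^esub> e)"
    using ex h(2) by simp
  then show "e \<otimes>\<^bsub>R\<^esub> x = x \<otimes>\<^bsub>R\<^esub> e"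
    using h(5) ex by (auto simp: bij_betw_def inj_on_def)
qed

lemma ring_iso_eq_zero_iff:
  assumes "ring R" "ring S" "h \<in> ring_iso R S" "x \<in> carrier R"
  shows "h x = \<zero>\<^bsub>S\<^esub> \<longleftrightarrow> x = \<zero>\<^bsub>R\<^esub>"
proof -
  interpret R: ring R by fact
  note h = ring_iso_memE[OF assms(3)]
  have "h \<zero>\<^bsub>R\<^esub> = \<zero>\<^bsub>S\<^esub>"
    using ring_hom_zero[OF _ assms(1,2)] assms(3) by (auto simp: ring_iso_def)
  then show ?thesis
    using inj_on_eq_iff[OF bij_betw_imp_inj_on[OF h(5)] assms(4) R.zero_closed] by simp
qed

text \<open>Applied in contrapositive form, to carry a failure from the ring of normal forms to the
  quotient.\<close>

lemma semicommutative_ring_iso: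
  assumes "ring R" "ring S" "h \<in> ring_iso R S" "semicommutative_ring S"
  shows "semicommutative_ring R"
  unfolding semicommutative_ring_def
proof (intro ballI impI)
  interpret R: ring R by fact
  fix a b r assume ab: "a \<in> carrier R" "b \<in> carrier R" "a \<otimes>\<^bsub>R\<^esub> b = \<zero>\<^bsub>R\<^esub>" and r: "r \<in> carrier R"
  note h = ring_iso_memE[OF assms(3)] and zero = ring_iso_eq_zero_iff[OF assms(1-3)]
  have "h a \<otimes>\<^bsub>S\<^esub> h b = \<zero>\<^bsub>S\<^esub>"
    using ab h(2)[of a b] zero[of "\<zero>\<^bsub>R\<^esub>"] by simp
  then have "h (a \<otimes>\<^bsub>R\<^esub> r \<otimes>\<^bsub>R\<^esub> b) = \<zero>\<^bsub>S\<^esub>"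
    using assms(4) ab r h(1,2) by (simp add: semicommutative_ring_def)
  then show "a \<otimes>\<^bsub>R\<^esub> r \<otimes>\<^bsub>R\<^esub> b = \<zero>\<^bsub>R\<^esub>"
    using zero ab r by simp
qed

lemma reflexive_ring_iso:
  assumes "ring R" "ring S" "h \<in> ring_iso R S" "reflexive_ring S"
  shows "reflexive_ring R"
  unfolding reflexive_ring_def
proof (intro ballI impI)
  interpret R: ring R by fact
  fix a b r assume ab: "a \<in> carrier R" "b \<in> carrier R"
    and null: "\<forall>r\<in>carrier R. a \<otimes>\<^bsub>R\<^esub> r \<otimes>\<^bsub>R\<^esub> b = \<zero>\<^bsub>R\<^esub>" and r: "r \<in> carrier R"
  note h = ring_iso_memE[OF assms(3)] and zero = ring_iso_eq_zero_iff[OF assms(1-3)]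
  \<comment> \<open>Here s ranges over all of S, so surjectivity of h is needed to write it as an
    image.\<close>
  have "h a \<otimes>\<^bsub>S\<^esub> s \<otimes>\<^bsub>S\<^esub> h b = \<zero>\<^bsub>S\<^esub>" if "s \<in> carrier S" for s
  proof -
    obtain t where t: "t \<in> carrier R" "s = h t"
      using h(5) \<open>s \<in> carrier S\<close> by (auto simp: bij_betw_def)
    have "h a \<otimes>\<^bsub>S\<^esub> s \<otimes>\<^bsub>S\<^esub> h b = h (a \<otimes>\<^bsub>R\<^esub> t \<otimes>\<^bsub>R\<^esub> b)"
      using t ab h(2) by simp
    then show ?thesis
      using null t zero[of "\<zero>\<^bsub>R\<^esub>"] by simp
  qed
  then have "h b \<otimes>\<^bsub>S\<^esub> h r \<otimes>\<^bsub>S\<^esub> h a = \<zero>\<^bsub>S\<^esub>"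
    using assms(4) ab r h(1) by (simp add: reflexive_ring_def)
  then have "h (b \<otimes>\<^bsub>R\<^esub> r \<otimes>\<^bsub>R\<^esub> a) = \<zero>\<^bsub>S\<^esub>"
    using ab r h(2) by simp
  then show "b \<otimes>\<^bsub>R\<^esub> r \<otimes>\<^bsub>R\<^esub> a = \<zero>\<^bsub>R\<^esub>"
    using zero ab r by simp
qed

section \<open>The example\<close>

text \<open>
  By default the simplifier turns \<open>+\<close> and \<open>*\<close> on \<^typ>\<open>bit\<close> into bit operations, which defeats
  normalisation by the ring laws.
\<close>

declare add_bit_eq_xor [simp del] mult_bit_eq_and [simp del]

text \<open>
  \<open>NF c0 c1 c2 c3 c4 c5\<close> stands for \<open>c0 + c1 u + c2 v + c3 uv + c4 vu + c5 uvu\<close>; the product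
  is the one forced by \<open>u\<^sup>2 = v\<^sup>2 = 0\<close> and \<open>uvu = vuv\<close>.
\<close>

datatype normal_form = NF bit bit bit bit bit bit

instantiation normal_form :: ring_1
begin

definition zero_normal_form :: normal_form where
  "0 = NF 0 0 0 0 0 0"

definition one_normal_form :: normal_form where
  "1 = NF 1 0 0 0 0 0"

fun plus_normal_form :: "normal_form \<Rightarrow> normal_form \<Rightarrow> normal_form" where
  "NF a0 a1 a2 a3 a4 a5 + NF b0 b1 b2 b3 b4 b5 =
    NF (a0 + b0) (a1 + b1) (a2 + b2) (a3 + b3) (a4 + b4) (a5 + b5)"

text \<open>Characteristic 2 makes negation the identity.\<close>

definition uminus_normal_form :: "normal_form \<Rightarrow> normal_form" where
  "- x = (x :: normal_form)"

definition minus_normal_form :: "normal_form \<Rightarrow> normal_form \<Rightarrow> normal_form" where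
  "x - y = (x + y :: normal_form)"

text \<open>Besides terms with a constant factor, the last coefficient collects u.vu, uv.u, v.uv and
  vu.v, using vuv = uvu. Longer words vanish, for instance uvuv = u(vuv) = u(uvu) = 0.\<close>

fun times_normal_form :: "normal_form \<Rightarrow> normal_form \<Rightarrow> normal_form" where
  "NF a0 a1 a2 a3 a4 a5 * NF b0 b1 b2 b3 b4 b5 =
    NF (a0 * b0) (a0 * b1 + a1 * b0) (a0 * b2 + a2 * b0)
      (a0 * b3 + a3 * b0 + a1 * b2) (a0 * b4 + a4 * b0 + a2 * b1)
      (a0 * b5 + a5 * b0 + a1 * b4 + a3 * b1 + a2 * b3 + a4 * b2)"

instance
proof
  fix a b c :: normal_form
  show "a + b + c = a + (b + c)" "a * b * c = a * (b * c)"
    by (cases a; cases b; cases c; simp add: algebra_simps)+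
  show "(a + b) * c = a * c + b * c" "a * (b + c) = a * b + a * c"
    by (cases a; cases b; cases c; simp add: algebra_simps)+
  show "a + b = b + a"
    by (cases a; cases b; simp add: ac_simps)
  show "0 + a = a" "- a + a = 0" "1 * a = a" "a * 1 = a" "a - b = a + - b"
    by (cases a; simp add: zero_normal_form_def one_normal_form_def uminus_normal_form_def
        minus_normal_form_def)+
  show "(0 :: normal_form) \<noteq> 1"
    by (simp add: zero_normal_form_def one_normal_form_def)
qed

end

section \<open>Order and properties of the ring of normal forms\<close>

lemma UNIV_bit: "(UNIV :: bit set) = {0, 1}"
  by (auto simp: bit_not_zero_iff)

lemma card_normal_form: "card (UNIV :: normal_form set) = 64"
proof -
  have "bij_betw (\<lambda>(a, b, c, d, e, f). NF a b c d e f) UNIV UNIV"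
    by (rule bij_betwI[where g = "\<lambda>x. case x of NF a b c d e f \<Rightarrow> (a, b, c, d, e, f)"])
      (auto split: normal_form.splits)
  then have "card (UNIV :: normal_form set) =
      card (UNIV :: (bit \<times> bit \<times> bit \<times> bit \<times> bit \<times> bit) set)"
    by (simp add: bij_betw_same_card)
  also have "\<dots> = 64"
    by (simp add: card_cartesian_product UNIV_bit flip: UNIV_Times_UNIV)
  finally show ?thesis .
qed

abbreviation nf_ring :: "normal_form ring" where
  "nf_ring \<equiv> ring_of_type_algebra"

lemma abelian_ring_nf_ring: "abelian_ring nf_ring"
proof -
  \<comment> \<open>Comparing coefficients by increasing word length, either value of the constant
    term forces all others to vanish.\<close>
  have "e = 0 \<or> e = 1" if "e * e = e" for e :: normal_form
  proof (cases e)
    case (NF e0 e1 e2 e3 e4 e5)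
    with that show ?thesis
      by (cases e0) (auto simp: zero_normal_form_def one_normal_form_def)
  qed
  then have "e * x = x * e" if "e * e = e" for e x :: normal_form
    using that by fastforce
  then show ?thesis
    unfolding abelian_ring_def ring_of_type_algebra_simps by blast
qed

lemma not_semicommutative_ring_nf_ring: "\<not> semicommutative_ring nf_ring"
proof
  let ?u = "NF 0 1 0 0 0 0" and ?v = "NF 0 0 1 0 0 0"
  assume "semicommutative_ring nf_ring"
  moreover have "?u * ?u = 0"
    by (simp add: zero_normal_form_def)
  ultimately have "?u * ?v * ?u = 0"
    by (simp add: semicommutative_ring_def del: times_normal_form.simps)
  then show False
    by (simp add: zero_normal_form_def)
qed

text \<open>The pair u, uv works: in u r uv the constant part of r meets uu = 0, and every other
  part yields words of length at least four, which are zero. In the opposite order r = 1 gives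
  uvu.\<close>

lemma not_reflexive_ring_nf_ring: "\<not> reflexive_ring nf_ring"
proof
  let ?u = "NF 0 1 0 0 0 0" and ?uv = "NF 0 0 0 1 0 0"
  assume "reflexive_ring nf_ring"
  moreover have "?u * r * ?uv = 0" for r
    by (cases r) (simp add: zero_normal_form_def)
  ultimately have "?uv * 1 * ?u = 0"
    unfolding reflexive_ring_def ring_of_type_algebra_simps by blast
  then show False
    by (simp add: zero_normal_form_def)
qed

section \<open>The free algebra and its evaluation\<close>

lemma free_algebra_induct [case_names zero single add]:
  fixes p :: "('x, 'k::ring_1) free_algebra"
  assumes "P 0" and "\<And>w c. P (Poly_Mapping.single w c)" and "\<And>p q. P p \<Longrightarrow> P q \<Longrightarrow> P (p + q)"
  shows "P p"
proof (induction p rule: Poly_Mapping.update_induct)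
  case const
  show ?case by fact
next
  case (update f a b)
  \<comment> \<open>The updated key is fresh, so the update amounts to adding a monomial.\<close>
  have "Poly_Mapping.update a b f = f + Poly_Mapping.single a b"
    using update(1)
    by (intro poly_mapping_eqI)
      (auto simp: lookup_update lookup_add lookup_single in_keys_iff when_def)
  then show ?case
    using assms(2,3) update by simp
qed

definition nf_const :: "bit \<Rightarrow> normal_form" where
  "nf_const c = NF c 0 0 0 0 0"

lemma nf_const_simps: "nf_const 0 = 0" "nf_const 1 = 1" "nf_const (a + b) = nf_const a + nf_const b"
  "nf_const (a * b) = nf_const a * nf_const b"
  by (simp_all add: nf_const_def zero_normal_form_def one_normal_form_def)

lemma nf_const_commute: "nf_const c * x = x * nf_const c"
  by (cases x) (simp add: nf_const_def ac_simps)

fun nf_letter :: "uv \<Rightarrow> normal_form" where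
  "nf_letter U = NF 0 1 0 0 0 0"
| "nf_letter V = NF 0 0 1 0 0 0"

definition nf_word :: "uv free_monoid \<Rightarrow> normal_form" where
  "nf_word w = prod_list (map nf_letter (letters w))"

lemma nf_word_add: "nf_word (x + y) = nf_word x * nf_word y"
  by (simp add: nf_word_def plus_free_monoid_def)

definition nf_eval :: "F2_uv \<Rightarrow> normal_form" where
  "nf_eval p = (\<Sum>w\<in>Poly_Mapping.keys p. nf_const (Poly_Mapping.lookup p w) * nf_word w)"

text \<open>Cancellation may shrink the support of a sum; padding with zero terms lets several
  evaluations share one index set.\<close>

lemma nf_eval_superset:
  assumes "finite A" "Poly_Mapping.keys p \<subseteq> A"
  shows "nf_eval p = (\<Sum>w\<in>A. nf_const (Poly_Mapping.lookup p w) * nf_word w)"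
  unfolding nf_eval_def using assms
  by (intro sum.mono_neutral_left) (auto simp: in_keys_iff nf_const_simps)

lemma nf_eval_zero: "nf_eval 0 = 0"
  by (simp add: nf_eval_def)

lemma nf_eval_add: "nf_eval (p + q) = nf_eval p + nf_eval q"
proof -
  let ?A = "Poly_Mapping.keys p \<union> Poly_Mapping.keys q"
  have "Poly_Mapping.keys (p + q) \<subseteq> ?A"
    by (rule keys_add)
  then show ?thesis
    by (simp add: nf_eval_superset[of ?A] lookup_add nf_const_simps distrib_right sum.distrib)
qed

lemma nf_eval_single: "nf_eval (Poly_Mapping.single w c) = nf_const c * nf_word w"
  by (subst nf_eval_superset[of "{w}"]) simp_all

text \<open>Both sides are additive in p and in q, which reduces the claim to monomials; there the
  central constants are moved past words.\<close>

lemma nf_eval_mult: "nf_eval (p * q) = nf_eval p * nf_eval q"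
proof (induction p rule: free_algebra_induct)
  case (single w c)
  show ?case
  proof (induction q rule: free_algebra_induct)
    case (single w' c')
    have "nf_const c * nf_const c' * (nf_word w * nf_word w') =
        nf_const c * (nf_const c' * nf_word w) * nf_word w'"
      by (simp add: mult.assoc)
    also have "\<dots> = nf_const c * nf_word w * (nf_const c' * nf_word w')"
      by (metis mult.assoc nf_const_commute)
    finally show ?case
      by (simp add: mult_single nf_eval_single nf_word_add nf_const_simps)
  qed (simp_all add: nf_eval_zero nf_eval_add distrib_left)
qed (simp_all add: nf_eval_zero nf_eval_add distrib_right)

lemma nf_eval_generator: "nf_eval (generator x) = nf_letter x"
  by (simp add: generator_def nf_eval_single nf_const_simps nf_word_def)

lemma nf_eval_minus: "nf_eval (p - q) = nf_eval p - nf_eval q"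
  using nf_eval_add[of "p - q" q] by (simp add: algebra_simps)

section \<open>Reduction to normal form modulo the relators\<close>

definition relator_ideal :: "F2_uv set" where
  "relator_ideal = Idl\<^bsub>F2_uv_ring\<^esub> uv_relators"

lemma ring_F2_uv_ring: "ring F2_uv_ring"
  unfolding F2_uv_ring_def by (rule ring_ring_of_type_algebra)

lemma ideal_relator_ideal: "ideal relator_ideal F2_uv_ring"
  unfolding relator_ideal_def
  by (rule ring.genideal_ideal[OF ring_F2_uv_ring]) (simp add: F2_uv_ring_def)

lemma relator_ideal_closed:
  assumes "p \<in> relator_ideal"
  shows "q \<in> relator_ideal \<Longrightarrow> p + q \<in> relator_ideal" "q * p \<in> relator_ideal" "p * q \<in> relator_ideal"
proof -
  interpret ideal relator_ideal F2_uv_ring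
    by (rule ideal_relator_ideal)
  show "q \<in> relator_ideal \<Longrightarrow> p + q \<in> relator_ideal"
    using additive_subgroup.a_closed[OF is_additive_subgroup assms] by (simp add: F2_uv_ring_def)
  show "q * p \<in> relator_ideal" "p * q \<in> relator_ideal"
    using I_l_closed[OF assms, of q] I_r_closed[OF assms, of q] by (simp_all add: F2_uv_ring_def)
qed

lemma zero_in_relator_ideal: "0 \<in> relator_ideal"
  using additive_subgroup.zero_closed[OF ideal.axioms(1)[OF ideal_relator_ideal]]
  by (simp add: F2_uv_ring_def)

abbreviation word :: "uv list \<Rightarrow> bit \<Rightarrow> F2_uv" where
  "word w c \<equiv> Poly_Mapping.single (Word w) c"

lemma word_mult: "word x c * word y d = word (x @ y) (c * d)"
  by (simp add: mult_single plus_free_monoid_def)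

lemma relators_in_relator_ideal:
  "word [U, U] 1 \<in> relator_ideal" "word [V, V] 1 \<in> relator_ideal"
  "word [V, U, V] 1 - word [U, V, U] 1 \<in> relator_ideal"
proof -
  have "uv_relators \<subseteq> relator_ideal"
    unfolding relator_ideal_def
    by (rule ring.genideal_self[OF ring_F2_uv_ring]) (simp add: F2_uv_ring_def)
  then show "word [U, U] 1 \<in> relator_ideal" "word [V, V] 1 \<in> relator_ideal"
    and "word [V, U, V] 1 - word [U, V, U] 1 \<in> relator_ideal"
    \<comment> \<open>Multiplication by -1 turns uvu - vuv around, so that it rewrites vuv into the
      basis word uvu.\<close>
    using relator_ideal_closed(2)[of "word [U, V, U] 1 - word [V, U, V] 1" "-1"]
    by (simp_all add: uv_relators_def Let_def generator_def power2_eq_square word_mult)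
qed

lemma word_in_relator_ideal:
  "word (U # U # w) c \<in> relator_ideal" "word (V # V # w) c \<in> relator_ideal"
  "word (V # U # V # w) c - word (U # V # U # w) c \<in> relator_ideal"
  using relator_ideal_closed(3)[OF relators_in_relator_ideal(1), of "word w c"]
    relator_ideal_closed(3)[OF relators_in_relator_ideal(2), of "word w c"]
    relator_ideal_closed(3)[OF relators_in_relator_ideal(3), of "word w c"]
  by (simp_all add: word_mult left_diff_distrib)

text \<open>An additive right inverse of \<open>nf_eval\<close>, multiplicative only modulo the
  relators.\<close>

fun nf_section :: "normal_form \<Rightarrow> F2_uv" where
  "nf_section (NF c0 c1 c2 c3 c4 c5) =
    word [] c0 + word [U] c1 + word [V] c2 + word [U, V] c3 + word [V, U] c4 + word [U, V, U] c5"

lemma nf_section_add: "nf_section (x + y) = nf_section x + nf_section y"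
  by (cases x; cases y) (simp add: single_add ac_simps)

lemma nf_section_zero: "nf_section 0 = 0"
  by (simp add: zero_normal_form_def)

lemma nf_eval_section: "nf_eval (nf_section x) = x"
  by (cases x)
    (simp add: nf_eval_add nf_eval_single nf_word_def nf_const_def one_normal_form_def)

text \<open>The inductive step for words: after a letter is prepended to a normal form, only
  multiples of relators are left over.\<close>

lemma generator_mult_nf_section:
  "word [x] 1 * nf_section k - nf_section (nf_letter x * k) \<in> relator_ideal"
proof (cases k)
  case k: (NF c0 c1 c2 c3 c4 c5)
  show ?thesis
  proof (cases x)
    case U
    have "word [x] 1 * nf_section k - nf_section (nf_letter x * k) =
        word [U, U] c1 + word [U, U, V] c3 + word [U, U, V, U] c5"
      by (simp add: k U distrib_left word_mult)
    then show ?thesis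
      by (simp only:) (intro relator_ideal_closed(1) word_in_relator_ideal)
  next
    case V
    \<comment> \<open>The word vuvu takes two reductions: it is congruent to uvuu, which contains
      uu.\<close>
    have "word [x] 1 * nf_section k - nf_section (nf_letter x * k) =
        word [V, V] c2 + (word [V, U, V] c3 - word [U, V, U] c3) + word [V, V, U] c4 +
        (word [V, U, V, U] c5 - word [U, V, U, U] c5) + word [U, V] 1 * word [U, U] c5"
      by (simp add: k V distrib_left word_mult)
    moreover have "word [U, V] 1 * word [U, U] c5 \<in> relator_ideal"
      by (intro relator_ideal_closed(2) word_in_relator_ideal)
    ultimately show ?thesis
      by (simp only:) (intro relator_ideal_closed(1) word_in_relator_ideal)
  qed
qed

text \<open>Additivity reduces this to monomials, whose words are built by prepending letters. In
  the case \<open>nf_eval p = 0\<close> it puts p into the ideal.\<close>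

lemma diff_nf_section_in_relator_ideal: "p - nf_section (nf_eval p) \<in> relator_ideal"
proof (induction p rule: free_algebra_induct)
  case zero
  show ?case
    by (simp add: nf_eval_zero nf_section_zero zero_in_relator_ideal)
next
  case (single w c)
  have "word ws c - nf_section (nf_eval (word ws c)) \<in> relator_ideal" for ws
  proof (induction ws)
    case Nil
    show ?case
      by (simp add: nf_eval_single nf_word_def nf_const_def one_normal_form_def zero_in_relator_ideal)
  next
    case (Cons x ws)
    let ?k = "nf_eval (word ws c)"
    have split: "word (x # ws) c = word [x] 1 * word ws c"
      by (simp add: word_mult)
    have "nf_eval (word (x # ws) c) = nf_letter x * ?k"
      unfolding split nf_eval_mult by (simp add: nf_eval_single nf_word_def nf_const_simps)
    \<comment> \<open>The first summand is a multiple of the induction hypothesis, the second the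
      error of prepending a letter to a normal form.\<close>
    then have "word (x # ws) c - nf_section (nf_eval (word (x # ws) c)) =
        word [x] 1 * (word ws c - nf_section ?k) +
        (word [x] 1 * nf_section ?k - nf_section (nf_letter x * ?k))"
      unfolding split by (simp add: right_diff_distrib)
    then show ?case
      using relator_ideal_closed(1,2) Cons generator_mult_nf_section by metis
  qed
  then show ?case
    by (metis free_monoid.exhaust)
next
  case (add p q)
  have "p + q - nf_section (nf_eval (p + q)) =
      (p - nf_section (nf_eval p)) + (q - nf_section (nf_eval q))"
    by (simp add: nf_eval_add nf_section_add)
  then show ?case
    using relator_ideal_closed(1)[OF add] by (simp only:)
qed

section \<open>The quotient as the ring of normal forms\<close>

lemma ring_hom_ring_nf_eval: "ring_hom_ring F2_uv_ring nf_ring nf_eval"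
proof (rule ring_hom_ringI2)
  show "nf_eval \<in> ring_hom F2_uv_ring nf_ring"
    by (rule ring_hom_memI)
      (simp_all add: F2_uv_ring_def nf_eval_add nf_eval_mult nf_eval_single nf_word_def nf_const_simps
        zero_free_monoid_def flip: single_one)
qed (rule ring_F2_uv_ring ring_ring_of_type_algebra)+

lemma a_kernel_nf_eval: "a_kernel F2_uv_ring nf_ring nf_eval = relator_ideal"
proof
  have "uv_relators \<subseteq> a_kernel F2_uv_ring nf_ring nf_eval"
    by (simp add: uv_relators_def Let_def a_kernel_def' F2_uv_ring_def nf_eval_minus nf_eval_mult
        nf_eval_generator power2_eq_square zero_normal_form_def minus_normal_form_def)
  then show "relator_ideal \<subseteq> a_kernel F2_uv_ring nf_ring nf_eval"
    unfolding relator_ideal_def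
    by (intro ring.genideal_minimal ring_F2_uv_ring
        ring_hom_ring.kernel_is_ideal[OF ring_hom_ring_nf_eval])
  show "a_kernel F2_uv_ring nf_ring nf_eval \<subseteq> relator_ideal"
  proof
    fix p assume "p \<in> a_kernel F2_uv_ring nf_ring nf_eval"
    then show "p \<in> relator_ideal"
      using diff_nf_section_in_relator_ideal[of p] by (simp add: a_kernel_def' nf_section_zero)
  qed
qed

lemma uv_quotient_iso: "uv_quotient \<simeq> nf_ring"
proof -
  have "nf_eval ` carrier F2_uv_ring = carrier nf_ring"
    using surjI[of nf_eval, OF nf_eval_section] by (simp add: F2_uv_ring_def)
  from ring_hom_ring.FactRing_iso[OF ring_hom_ring_nf_eval this] show ?thesis
    by (simp only: a_kernel_nf_eval uv_quotient_def relator_ideal_def)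
qed

lemma ring_uv_quotient: "ring uv_quotient"
  using ideal.quotient_is_ring[OF ideal_relator_ideal]
  by (simp add: uv_quotient_def relator_ideal_def)

lemma not_semicommutative_ring_uv_quotient: "\<not> semicommutative_ring uv_quotient"
  and not_reflexive_ring_uv_quotient: "\<not> reflexive_ring uv_quotient"
proof -
  obtain h where "h \<in> ring_iso nf_ring uv_quotient"
    using ring_iso_sym[OF ring_uv_quotient uv_quotient_iso] by (auto simp: is_ring_iso_def)
  note iso = ring_ring_of_type_algebra ring_uv_quotient this
  show "\<not> semicommutative_ring uv_quotient"
    using semicommutative_ring_iso[OF iso] not_semicommutative_ring_nf_ring by blast
  show "\<not> reflexive_ring uv_quotient"
    using reflexive_ring_iso[OF iso] not_reflexive_ring_nf_ring by blast
qed

lemma abelian_ring_uv_quotient: "abelian_ring uv_quotient"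
  using uv_quotient_iso abelian_ring_iso[OF ring_uv_quotient ring_ring_of_type_algebra]
    abelian_ring_nf_ring
  by (auto simp: is_ring_iso_def)

lemma order_uv_quotient: "Coset.order uv_quotient = 64"
  using ring_iso_same_card[OF uv_quotient_iso] card_normal_form by (simp add: Coset.order_def)

text \<open>\<open>Coset.order\<close> is a \<open>card\<close>, which is 0 on an infinite carrier,
  so the lower bound speaks of finite rings; the example attains it.\<close>

theorem theorem3p4:
  shows "(\<forall>R :: ('a, 'm) ring_scheme.
            ring R \<and> finite (carrier R) \<and>
            abelian_ring R \<and> \<not> semicommutative_ring R \<and> \<not> reflexive_ring R
            \<longrightarrow> 64 \<le> Coset.order R)
       \<and> ring uv_quotient
       \<and> abelian_ring uv_quotient
       \<and> \<not> semicommutative_ring uv_quotient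
       \<and> \<not> reflexive_ring uv_quotient
       \<and> Coset.order uv_quotient = 64"
  using card_ge_64_if_not_semicommutative ring_uv_quotient abelian_ring_uv_quotient
    not_semicommutative_ring_uv_quotient not_reflexive_ring_uv_quotient order_uv_quotient
  by (auto simp: Coset.order_def)

end
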